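(* For every integer $k \geq 2$ there exists a perfect graph $G_k$ with $\chi_C(G_k) = k+1$ such that $G_k$ can be obtained from cobipartite graphs by repeatedly applying the operation of gluing graphs along a clique.
   Context: All graphs are simple, finite, and non-null (at least one vertex). A clique of a graph $G$ is a (possibly empty) set of pairwise adjacent vertices of $G$. A set of vertices is monochromatic if all its vertices received the same color. A clique-coloring of $G$ is an assignment of colors to the vertices of $G$ such that no inclusion-wise maximal clique of $G$ of size at least two is monochromatic. A $k$-clique-coloring of $G$ is a clique-coloring $\varphi: V(G) \to \{1,\ldots,k\}$, and $G$ is $k$-clique-colorable if it has a $k$-clique-coloring (not all colors need be used). The clique-chromatic number $\chi_C(G)$ is the smallest integer $k$ such that $G$ is $k$-clique-colorable. The clique number $\omega(G)$ is the maximum size of a clique of $G$. A graph $G$ is perfect if every induced subgraph $H$ of $G$ satisfies $\chi(H) = \omega(H)$, where $\chi$ denotes the usual chromatic number. A cobipartite graph is a graph whose complement is bipartite; equivalently, its vertex set can be partitioned into two (possibly empty) cliques. A graph $G$ is obtained by gluing graphs $G_1$ and $G_2$ along a clique if (up to isomorphism) $G_1$ and $G_2$ are induced subgraphs of $G$ with $V(G) = V(G_1)\cup V(G_2)$, $V(G_1)\cap V(G_2)$ is a clique of $G$, and there are no edges of $G$ between $V(G_1)\setminus V(G_2)$ and $V(G_2)\setminus V(G_1)$. *)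

theory Defs
  imports "Graph_Theory.Graph_Theory"
begin

text \<open>A simple undirected graph is a \<^const>\<open>pair_graph\<close>: a finite, symmetric, loop-free set of
  arcs on a finite vertex set. The library admits the null graph, which is excluded here.\<close>

definition simple_graph :: "'a pair_pre_digraph \<Rightarrow> bool" where
  "simple_graph G \<longleftrightarrow> pair_graph G \<and> pverts G \<noteq> {}"

definition is_clique :: "'a pair_pre_digraph \<Rightarrow> 'a set \<Rightarrow> bool" where
  "is_clique G S \<longleftrightarrow> S \<subseteq> pverts G \<and> (\<forall>u\<in>S. \<forall>v\<in>S. u \<noteq> v \<longrightarrow> u \<rightarrow>\<^bsub>with_proj G\<^esub> v)"

definition maximal_clique :: "'a pair_pre_digraph \<Rightarrow> 'a set \<Rightarrow> bool" where
  "maximal_clique G S \<longleftrightarrow> is_clique G S \<and> (\<forall>T. is_clique G T \<and> S \<subseteq> T \<longrightarrow> T = S)"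

definition clique_number :: "'a pair_pre_digraph \<Rightarrow> nat" where
  "clique_number G = Max (card ` {S. is_clique G S})"

definition monochromatic :: "('a \<Rightarrow> 'c) \<Rightarrow> 'a set \<Rightarrow> bool" where
  "monochromatic \<phi> S \<longleftrightarrow> (\<forall>u\<in>S. \<forall>v\<in>S. \<phi> u = \<phi> v)"

definition clique_coloring :: "'a pair_pre_digraph \<Rightarrow> ('a \<Rightarrow> 'c) \<Rightarrow> bool" where
  "clique_coloring G \<phi> \<longleftrightarrow> (\<forall>S. maximal_clique G S \<and> card S \<ge> 2 \<longrightarrow> \<not> monochromatic \<phi> S)"

definition clique_colorable :: "'a pair_pre_digraph \<Rightarrow> nat \<Rightarrow> bool" where
  "clique_colorable G k \<longleftrightarrow> (\<exists>\<phi> :: 'a \<Rightarrow> nat. \<phi> ` pverts G \<subseteq> {1..k} \<and> clique_coloring G \<phi>)"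

text \<open>A finite graph is colorable with one color per vertex in either sense, so both minima
  below are attained.\<close>

definition clique_chromatic_number :: "'a pair_pre_digraph \<Rightarrow> nat" where
  "clique_chromatic_number G = (LEAST k. clique_colorable G k)"

definition proper_coloring :: "'a pair_pre_digraph \<Rightarrow> ('a \<Rightarrow> 'c) \<Rightarrow> bool" where
  "proper_coloring G \<phi> \<longleftrightarrow> (\<forall>u v. u \<rightarrow>\<^bsub>with_proj G\<^esub> v \<longrightarrow> \<phi> u \<noteq> \<phi> v)"

definition colorable :: "'a pair_pre_digraph \<Rightarrow> nat \<Rightarrow> bool" where
  "colorable G k \<longleftrightarrow> (\<exists>\<phi> :: 'a \<Rightarrow> nat. \<phi> ` pverts G \<subseteq> {1..k} \<and> proper_coloring G \<phi>)"

definition chromatic_number :: "'a pair_pre_digraph \<Rightarrow> nat" where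
  "chromatic_number G = (LEAST k. colorable G k)"

definition perfect :: "'a pair_pre_digraph \<Rightarrow> bool" where
  "perfect G \<longleftrightarrow> simple_graph G \<and>
     (\<forall>H. simple_graph H \<and> induced_subgraph (with_proj H) (with_proj G)
        \<longrightarrow> chromatic_number H = clique_number H)"

definition complement_graph :: "'a pair_pre_digraph \<Rightarrow> 'a pair_pre_digraph" where
  "complement_graph G = \<lparr> pverts = pverts G,
     parcs = {(u, v). u \<in> pverts G \<and> v \<in> pverts G \<and> u \<noteq> v \<and> \<not> u \<rightarrow>\<^bsub>with_proj G\<^esub> v} \<rparr>"

definition bipartite :: "'a pair_pre_digraph \<Rightarrow> bool" where
  "bipartite G \<longleftrightarrow> simple_graph G \<and>
     (\<exists>A B. A \<union> B = pverts G \<and> A \<inter> B = {} \<and> 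
        (\<forall>u v. u \<rightarrow>\<^bsub>with_proj G\<^esub> v \<longrightarrow> (u \<in> A \<longleftrightarrow> v \<in> B)))"

definition cobipartite :: "'a pair_pre_digraph \<Rightarrow> bool" where
  "cobipartite G \<longleftrightarrow> simple_graph G \<and> bipartite (complement_graph G)"

text \<open>\<open>G\<^sub>1\<close> and \<open>G\<^sub>2\<close> only have to be isomorphic to the two induced subgraphs \<open>H\<^sub>1\<close>, \<open>H\<^sub>2\<close> of \<open>G\<close>
  that overlap in the clique.\<close>

definition glued_along_clique ::
    "'a pair_pre_digraph \<Rightarrow> 'a pair_pre_digraph \<Rightarrow> 'a pair_pre_digraph \<Rightarrow> bool" where
  "glued_along_clique G\<^sub>1 G\<^sub>2 G \<longleftrightarrow> simple_graph G \<and>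
     (\<exists>H\<^sub>1 H\<^sub>2.
        digraph_iso (with_proj G\<^sub>1) (with_proj H\<^sub>1) \<and> digraph_iso (with_proj G\<^sub>2) (with_proj H\<^sub>2) \<and>
        induced_subgraph (with_proj H\<^sub>1) (with_proj G) \<and>
        induced_subgraph (with_proj H\<^sub>2) (with_proj G) \<and>
        pverts G = pverts H\<^sub>1 \<union> pverts H\<^sub>2 \<and>
        is_clique G (pverts H\<^sub>1 \<inter> pverts H\<^sub>2) \<and>
        (\<forall>u \<in> pverts H\<^sub>1 - pverts H\<^sub>2. \<forall>v \<in> pverts H\<^sub>2 - pverts H\<^sub>1. \<not> u \<rightarrow>\<^bsub>with_proj G\<^esub> v))"

inductive glued_from_cobipartite :: "'a pair_pre_digraph \<Rightarrow> bool" where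
  cobipartite: "cobipartite G \<Longrightarrow> glued_from_cobipartite G"
| glue: "glued_from_cobipartite G\<^sub>1 \<Longrightarrow> glued_from_cobipartite G\<^sub>2 \<Longrightarrow> glued_along_clique G\<^sub>1 G\<^sub>2 G
    \<Longrightarrow> glued_from_cobipartite G"

end

(* Start from a single vertex and repeatedly attach a new clique B to an existing clique A, with
   arbitrary edges between A and B. This glues a cobipartite graph along A, and by Hall's theorem
   every coloring of an induced subgraph with omega colors extends to the new vertices, so all the
   graphs obtained are perfect.

   Suppose that a k-clique-coloring uses each color of a set C many times on a clique A. For each
   color c in C match the vertices of A of color c with the members of a family F c of subsets of
   B, and join each vertex to its set. If the families together form an antichain, then each vertex
   of A and its set form a maximal clique, so no member of F c is monochromatic of color c. If every
   popular color class of B contains a member of each F c, then a popular color d of B lies outside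
   C. A suitable set S of N vertices of B of color d is contained in many members of every F c, so S
   and its common neighbors in A form a clique on which each color of C and also d occurs at least N
   times. After k + 1 such rounds k colors do not suffice. One attachment raises the clique-chromatic
   number by at most one, so the value k + 1 is attained on the way. *)

theory Submission
  imports Defs
begin

section \<open>Hall's marriage theorem\<close>

text \<open>Induction on \<open>I\<close>. If a nonempty proper subfamily \<open>J\<close> is tight,
  it is matched inside its union \<open>U\<close> and the rest outside \<open>U\<close>; Hall's
  condition for \<open>K\<close> outside \<open>U\<close> comes from the condition for
  \<open>K \<union> J\<close>. If none is tight, every nonempty proper subfamily has an element to
  spare, so any choice for one index can be removed from the other sets.\<close>

lemma hall:
  fixes S :: "'i \<Rightarrow> 'a set"
  assumes "finite I" and "\<And>i. i \<in> I \<Longrightarrow> finite (S i)"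
    and "\<And>J. J \<subseteq> I \<Longrightarrow> card J \<le> card (\<Union>(S ` J))"
  shows "\<exists>f. inj_on f I \<and> (\<forall>i\<in>I. f i \<in> S i)"
  using assms
proof (induction I arbitrary: S rule: finite_psubset_induct)
  case (psubset I)
  show ?case
  proof (cases "\<exists>J. J \<subset> I \<and> J \<noteq> {} \<and> card (\<Union>(S ` J)) = card J")
    case True
    then obtain J where J: "J \<subset> I" "J \<noteq> {}" and tight: "card (\<Union>(S ` J)) = card J"
      by blast
    define U where "U = \<Union>(S ` J)"
    have finJ: "finite J" using J psubset.hyps finite_subset by blast
    have finU: "finite U" using J psubset.prems(1) finJ by (auto simp: U_def)
    have "\<exists>f. inj_on f J \<and> (\<forall>i\<in>J. f i \<in> S i)"
    proof (rule psubset.IH[OF J(1)])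
      show "finite (S i)" if "i \<in> J" for i using that J psubset.prems(1) by blast
      show "card K \<le> card (\<Union>(S ` K))" if "K \<subseteq> J" for K
        using that J psubset.prems(2) by blast
    qed
    then obtain f where f: "inj_on f J" "\<forall>i\<in>J. f i \<in> S i" by blast
    have "\<exists>g. inj_on g (I - J) \<and> (\<forall>i\<in>I - J. g i \<in> S i - U)"
    proof (rule psubset.IH)
      show "I - J \<subset> I" using J by blast
      show "finite (S i - U)" if "i \<in> I - J" for i using that psubset.prems(1) by blast
      fix K assume K: "K \<subseteq> I - J"
      have finK: "finite K" using K psubset.hyps finite_subset by blast
      have "card K + card J = card (K \<union> J)"
        using K finJ finK by (subst card_Un_disjoint) auto
      also have "\<dots> \<le> card (\<Union>(S ` (K \<union> J)))"
        using K J by (intro psubset.prems(2)) auto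
      also have "\<Union>(S ` (K \<union> J)) = (\<Union>i\<in>K. S i - U) \<union> U"
        by (auto simp: U_def)
      also have "card \<dots> \<le> card (\<Union>i\<in>K. S i - U) + card U"
        by (rule card_Un_le)
      finally show "card K \<le> card (\<Union>i\<in>K. S i - U)"
        using tight by (simp add: U_def)
    qed
    then obtain g where g: "inj_on g (I - J)" "\<forall>i\<in>I - J. g i \<in> S i - U" by blast
    have inU: "f i \<in> U" if "i \<in> J" for i using f that by (auto simp: U_def)
    show ?thesis
    proof (intro exI[of _ "\<lambda>i. if i \<in> J then f i else g i"] conjI)
      show "inj_on (\<lambda>i. if i \<in> J then f i else g i) I"
        unfolding inj_on_def using f(1) g inU by (auto dest: inj_onD) (metis DiffI)+
    qed (use f g in auto)
  next
    case notight: False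
    show ?thesis
    proof (cases "I = {}")
      case False
      then obtain i where i: "i \<in> I" by blast
      have "card {i} \<le> card (S i)" using psubset.prems(2)[of "{i}"] i by simp
      then obtain x where x: "x \<in> S i" by fastforce
      have "\<exists>g. inj_on g (I - {i}) \<and> (\<forall>j\<in>I - {i}. g j \<in> S j - {x})"
      proof (rule psubset.IH)
        show "I - {i} \<subset> I" using i by blast
        show "finite (S j - {x})" if "j \<in> I - {i}" for j using that psubset.prems(1) by blast
        fix K assume K: "K \<subseteq> I - {i}"
        show "card K \<le> card (\<Union>j\<in>K. S j - {x})"
        proof (cases "K = {}")
          case False
          have "K \<subset> I" using K i by blast
          then have "card K \<noteq> card (\<Union>(S ` K))" using notight False by metis
          moreover have "card K \<le> card (\<Union>(S ` K))" using \<open>K \<subset> I\<close> by (intro psubset.prems(2)) auto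
          moreover have "(\<Union>j\<in>K. S j - {x}) = \<Union>(S ` K) - {x}" by auto
          moreover have "card (\<Union>(S ` K)) \<le> Suc (card (\<Union>(S ` K) - {x}))"
            by (auto simp: card_Diff_singleton_if)
          ultimately show ?thesis by simp
        qed auto
      qed
      then obtain g where g: "inj_on g (I - {i})" "\<forall>j\<in>I - {i}. g j \<in> S j - {x}" by blast
      show ?thesis
      proof (intro exI[of _ "g(i := x)"] conjI)
        show "inj_on (g(i := x)) I"
          unfolding inj_on_def using g by (auto dest: inj_onD)
      qed (use g x in auto)
    qed auto
  qed
qed

section \<open>Attaching a clique to a clique\<close>

lemma simple_graph_iff:
  "simple_graph G \<longleftrightarrow> finite (pverts G) \<and> pverts G \<noteq> {} \<and> parcs G \<subseteq> pverts G \<times> pverts G \<and>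
     sym (parcs G) \<and> irrefl (parcs G)"
proof -
  have "finite (parcs G)" if "finite (pverts G)" "parcs G \<subseteq> pverts G \<times> pverts G"
    using that finite_subset by blast
  then show ?thesis
    unfolding simple_graph_def pair_graph_def pair_digraph_def pair_pseudo_graph_def
      pair_fin_digraph_def pair_fin_digraph_axioms_def pair_loopfree_digraph_def
      pair_loopfree_digraph_axioms_def pair_sym_digraph_def pair_sym_digraph_axioms_def
      pair_wf_digraph_def symmetric_def irrefl_def
    by auto
qed

lemma induced_subgraph_with_proj_iff:
  assumes "simple_graph G" "simple_graph H"
  shows "induced_subgraph (with_proj H) (with_proj G) \<longleftrightarrow>
    pverts H \<subseteq> pverts G \<and> parcs H = parcs G \<inter> pverts H \<times> pverts H"
proof -
  have "wf_digraph (with_proj G)" "wf_digraph (with_proj H)"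
    using assms by (auto simp: simple_graph_iff wf_digraph_def)
  then show ?thesis
    by (auto simp: induced_subgraph_def subgraph_def compatible_def)
qed

text \<open>Gluing is defined up to isomorphism; the two parts of an attachment are literally
  subgraphs, so the identity serves for both.\<close>

lemma digraph_iso_refl:
  assumes "wf_digraph G"
  shows "digraph_iso G G"
  unfolding digraph_iso_def
proof (intro exI conjI)
  let ?f = "\<lparr>iso_verts = id, iso_arcs = id, iso_head = head G, iso_tail = tail G\<rparr>"
  show "pre_digraph.digraph_isomorphism G ?f"
    using assms by (simp add: pre_digraph.digraph_isomorphism_def)
  show "G = app_iso ?f G" by (simp add: app_iso_def)
qed

lemma is_clique_iff:
  "is_clique G S \<longleftrightarrow> S \<subseteq> pverts G \<and> (\<forall>u\<in>S. \<forall>v\<in>S. u \<noteq> v \<longrightarrow> (u, v) \<in> parcs G)"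
  by (simp add: is_clique_def)

lemma is_clique_arc: "is_clique G S \<Longrightarrow> u \<in> S \<Longrightarrow> v \<in> S \<Longrightarrow> u \<noteq> v \<Longrightarrow> (u, v) \<in> parcs G"
  by (simp add: is_clique_iff)

lemma is_clique_mono: "is_clique G S \<Longrightarrow> T \<subseteq> S \<Longrightarrow> is_clique G T"
  by (auto simp: is_clique_iff)

text \<open>The cross edges are given from the side of \<open>A\<close> because the construction
  assigns to each old vertex a member of a set family on \<open>B\<close>.\<close>

definition attach_clique ::
    "'a pair_pre_digraph \<Rightarrow> 'a set \<Rightarrow> 'a set \<Rightarrow> ('a \<Rightarrow> 'a set) \<Rightarrow> 'a pair_pre_digraph" where
  "attach_clique G A B nb = \<lparr> pverts = pverts G \<union> B,
     parcs = parcs G \<union> {(b, b'). b \<in> B \<and> b' \<in> B \<and> b \<noteq> b'} \<union>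
       {(a, b). a \<in> A \<and> b \<in> nb a} \<union> {(b, a). a \<in> A \<and> b \<in> nb a} \<rparr>"

text \<open>The vertex in \<open>free_old\<close> keeps every vertex of \<open>B\<close> from being complete to \<open>A\<close>, so that no maximal
  clique of \<open>G\<close> is destroyed; the vertex in \<open>free_new\<close> breaks the monochromaticity of \<open>B\<close> when \<open>B\<close>
  receives one new color.\<close>

locale clique_attachment =
  fixes G :: "'a pair_pre_digraph" and A B :: "'a set" and nb :: "'a \<Rightarrow> 'a set"
  assumes simple: "simple_graph G"
    and clique: "is_clique G A"
    and finite_B: "finite B"
    and fresh: "B \<inter> pverts G = {}"
    and nb: "a \<in> A \<Longrightarrow> nb a \<subseteq> B"
    and free_old: "\<exists>a\<in>A. nb a = {}"
    and free_new: "\<exists>b\<in>B. \<forall>a\<in>A. b \<notin> nb a"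
begin

section \<open>Adjacency, cliques and colorings after an attachment\<close>

abbreviation G' where "G' \<equiv> attach_clique G A B nb"

lemma pverts_attach [simp]: "pverts G' = pverts G \<union> B"
  by (simp add: attach_clique_def)

lemma A_subset: "A \<subseteq> pverts G"
  using clique by (simp add: is_clique_iff)

lemma fresh_notin: "b \<in> B \<Longrightarrow> b \<notin> pverts G"
  using fresh by blast

lemma arc_old_iff: "u \<in> pverts G \<Longrightarrow> v \<in> pverts G \<Longrightarrow> (u, v) \<in> parcs G' \<longleftrightarrow> (u, v) \<in> parcs G"
  using fresh nb by (auto simp: attach_clique_def)

lemma arc_new_iff: "u \<in> B \<Longrightarrow> v \<in> B \<Longrightarrow> (u, v) \<in> parcs G' \<longleftrightarrow> u \<noteq> v"
  using fresh simple A_subset by (auto simp: attach_clique_def simple_graph_iff)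

lemma arc_mixed_iff:
  assumes "u \<in> pverts G" "b \<in> B"
  shows "(u, b) \<in> parcs G' \<longleftrightarrow> u \<in> A \<and> b \<in> nb u"
    and "(b, u) \<in> parcs G' \<longleftrightarrow> u \<in> A \<and> b \<in> nb u"
  using assms fresh simple A_subset by (auto simp: attach_clique_def simple_graph_iff)

lemma simple_attach: "simple_graph G'"
  using simple finite_B fresh nb A_subset
  by (auto simp: simple_graph_iff attach_clique_def sym_def irrefl_def)

text \<open>New vertices are pairwise adjacent, so only the old part and the pairs across impose
  conditions.\<close>

lemma clique_attach_iff:
  "is_clique G' S \<longleftrightarrow> S \<subseteq> pverts G \<union> B \<and> is_clique G (S \<inter> pverts G) \<and>
     (\<forall>v\<in>S \<inter> pverts G. \<forall>b\<in>S \<inter> B. v \<in> A \<and> b \<in> nb v)" (is "_ \<longleftrightarrow> ?R")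
proof
  assume S: "is_clique G' S"
  have "v \<in> A \<and> b \<in> nb v" if "v \<in> S \<inter> pverts G" "b \<in> S \<inter> B" for v b
  proof -
    have "v \<noteq> b" using that fresh by blast
    then have "(v, b) \<in> parcs G'" using that S by (simp add: is_clique_iff)
    then show ?thesis using that arc_mixed_iff(1)[of v b] by simp
  qed
  moreover have "is_clique G (S \<inter> pverts G)"
    unfolding is_clique_iff[of G]
  proof (intro conjI ballI impI)
    fix u v assume "u \<in> S \<inter> pverts G" "v \<in> S \<inter> pverts G" "u \<noteq> v"
    then show "(u, v) \<in> parcs G" using is_clique_arc[OF S] arc_old_iff by blast
  qed simp
  ultimately show ?R using S by (auto simp: is_clique_iff)
next
  assume R: ?R
  have "(u, v) \<in> parcs G'" if "u \<in> S" "v \<in> S" "u \<noteq> v" for u v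
  proof -
    have "u \<in> pverts G \<union> B" "v \<in> pverts G \<union> B" using R that by auto
    then consider "u \<in> pverts G" "v \<in> pverts G" | "u \<in> B" "v \<in> B"
      | "u \<in> pverts G" "v \<in> B" | "u \<in> B" "v \<in> pverts G"
      by blast
    then show ?thesis
    proof cases
      case 1
      then show ?thesis
        using that R arc_old_iff is_clique_arc[of G "S \<inter> pverts G" u v] by simp
    next
      case 2
      then show ?thesis using that arc_new_iff by simp
    next
      case 3
      then have "u \<in> A \<and> v \<in> nb u" using R that by blast
      then show ?thesis using 3 arc_mixed_iff(1) by simp
    next
      case 4
      then have "v \<in> A \<and> u \<in> nb v" using R that by blast
      then show ?thesis using 4 arc_mixed_iff(2) by simp
    qed
  qed
  then show "is_clique G' S" using R by (simp add: is_clique_iff[of G'])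
qed

lemma clique_attach_mixed:
  assumes "is_clique G' S" "v \<in> S" "v \<in> pverts G" "b \<in> S" "b \<in> B"
  shows "v \<in> A" "b \<in> nb v"
  using assms by (simp_all add: clique_attach_iff)

lemma clique_attach_old:
  assumes "is_clique G S"
  shows "is_clique G' S"
proof -
  have "S \<subseteq> pverts G" using assms by (simp add: is_clique_iff)
  then have "S \<inter> pverts G = S" "S \<inter> B = {}" using fresh by auto
  then show ?thesis using assms by (auto simp: clique_attach_iff)
qed

text \<open>If a clique containing \<open>S\<close> has a new vertex, that vertex is adjacent to all
  of \<open>S\<close>. Then \<open>S\<close> lies in \<open>A\<close>, hence equals \<open>A\<close>
  by maximality, contrary to the vertex of \<open>A\<close> without new neighbors in
  \<open>free_old\<close>. Consequently clique-colorings of \<open>G'\<close> are clique-colorings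
  of \<open>G\<close>.\<close>

lemma maximal_clique_attach:
  assumes S: "maximal_clique G S"
  shows "maximal_clique G' S"
  unfolding maximal_clique_def
proof (intro conjI allI impI; (elim conjE)?)
  show "is_clique G' S"
    using S clique_attach_old by (simp add: maximal_clique_def)
  fix T assume T: "is_clique G' T" "S \<subseteq> T"
  have SV: "S \<subseteq> pverts G" using S by (simp add: maximal_clique_def is_clique_iff)
  show "T = S"
  proof (cases "T \<inter> B = {}")
    case True
    then have "is_clique G T"
    proof -
      have "T \<inter> pverts G = T" using True T by (auto simp: clique_attach_iff)
      then show ?thesis using T by (simp add: clique_attach_iff)
    qed
    then show ?thesis using S T by (simp add: maximal_clique_def)
  next
    case False
    then obtain b where b: "b \<in> T" "b \<in> B" by blast
    then have *: "\<forall>v\<in>S. v \<in> A \<and> b \<in> nb v"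
      using T SV by (auto simp: clique_attach_iff)
    then have "S \<subseteq> A" by blast
    then have "A = S" using S clique by (simp add: maximal_clique_def)
    then show ?thesis using * free_old by auto
  qed
qed

lemma maximal_clique_attachD:
  assumes "maximal_clique G' S" "S \<subseteq> pverts G"
  shows "maximal_clique G S"
  unfolding maximal_clique_def
proof (intro conjI allI impI; (elim conjE)?)
  show "is_clique G S"
    using assms by (simp add: maximal_clique_def clique_attach_iff Int_absorb2)
  show "T = S" if "is_clique G T" "S \<subseteq> T" for T
    using assms(1) that clique_attach_old by (simp add: maximal_clique_def)
qed

lemma clique_coloring_attachD: "clique_coloring G' \<phi> \<Longrightarrow> clique_coloring G \<phi>"
  using maximal_clique_attach by (auto simp: clique_coloring_def)

text \<open>A new color goes to all of \<open>B\<close> except a vertex \<open>b0\<close> without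
  old neighbors, which gets color 1. A maximal clique of size at least two through \<open>b0\<close>
  lies in \<open>B\<close> and sees both colors. A monochromatic clique that meets \<open>B\<close>
  but misses \<open>b0\<close> has no old vertex, so \<open>b0\<close> could be added to it.\<close>

lemma clique_colorable_attach:
  assumes "clique_colorable G k" and k: "k \<ge> 1"
  shows "clique_colorable G' (k + 1)"
proof -
  obtain \<phi> :: "'a \<Rightarrow> nat" where \<phi>: "\<phi> ` pverts G \<subseteq> {1..k}" "clique_coloring G \<phi>"
    using assms by (auto simp: clique_colorable_def)
  obtain b0 where b0: "b0 \<in> B" "\<forall>a\<in>A. b0 \<notin> nb a" using free_new by blast
  define \<psi> where "\<psi> v = (if v \<in> pverts G then \<phi> v else if v = b0 then 1 else k + 1)" for v
  have "\<not> monochromatic \<psi> S" if S: "maximal_clique G' S" "card S \<ge> 2" for S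
  proof
    assume mono: "monochromatic \<psi> S"
    have S': "is_clique G' S" using S by (simp add: maximal_clique_def)
    have Ssub: "S \<subseteq> pverts G \<union> B" using S' by (simp add: is_clique_iff)
    consider "S \<subseteq> pverts G" | "b0 \<in> S" | b where "b \<in> S" "b \<in> B" "b0 \<notin> S"
      using Ssub by blast
    then show False
    proof cases
      case 1
      then have "maximal_clique G S" using S maximal_clique_attachD by blast
      then have "\<not> monochromatic \<phi> S" using \<phi> S by (auto simp: clique_coloring_def)
      moreover have "monochromatic \<phi> S" using mono 1 unfolding monochromatic_def \<psi>_def by (metis subsetD)
      ultimately show False by blast
    next
      case 2
      have "S \<subseteq> B"
      proof
        fix v assume v: "v \<in> S"
        show "v \<in> B"
        proof (rule ccontr)
          assume "v \<notin> B"
          then have "v \<in> S \<inter> pverts G" "b0 \<in> S \<inter> B" using v Ssub 2 b0 by auto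
          then show False using S' b0 unfolding clique_attach_iff by blast
        qed
      qed
      have "\<not> S \<subseteq> {b0}"
        using S(2) card_mono[of "{b0}" S] by auto
      then obtain b where "b \<in> S" "b \<noteq> b0" by blast
      moreover have "b \<notin> pverts G" "b0 \<notin> pverts G"
        using \<open>S \<subseteq> B\<close> \<open>b \<in> S\<close> b0(1) by (auto intro!: fresh_notin)
      ultimately have "\<psi> b = k + 1" "\<psi> b0 = 1" by (simp_all add: \<psi>_def)
      moreover have "\<psi> b = \<psi> b0" using mono 2 \<open>b \<in> S\<close> unfolding monochromatic_def by blast
      ultimately show False using k by simp
    next
      case (3 b)
      then have "b \<notin> pverts G" "b \<noteq> b0" using fresh_notin by auto
      then have b: "\<psi> b = k + 1" by (simp add: \<psi>_def)
      have "S \<inter> pverts G = {}"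
      proof (rule ccontr)
        assume "S \<inter> pverts G \<noteq> {}"
        then obtain v where v: "v \<in> S" "v \<in> pverts G" by blast
        then have "\<psi> v \<le> k" using \<phi>(1) by (simp add: \<psi>_def image_subset_iff)
        moreover have "\<psi> v = \<psi> b" using mono v 3 unfolding monochromatic_def by blast
        ultimately show False using b by simp
      qed
      moreover have "b0 \<notin> pverts G" using b0(1) by (rule fresh_notin)
      ultimately have "is_clique G' (insert b0 S)"
        using Ssub b0 by (simp add: clique_attach_iff is_clique_iff[of G])
      then have "insert b0 S = S" using S(1) unfolding maximal_clique_def by blast
      then show False using 3 by blast
    qed
  qed
  moreover have "\<psi> ` pverts G' \<subseteq> {1..k + 1}"
    using \<phi>(1) k by (simp add: \<psi>_def image_subset_iff le_SucI)
  ultimately have "\<psi> ` pverts G' \<subseteq> {1..k + 1} \<and> clique_coloring G' \<psi>"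
    unfolding clique_coloring_def by (intro conjI allI impI; (elim conjE)?)
  then show ?thesis
    unfolding clique_colorable_def by (rule exI[of _ \<psi>])
qed

text \<open>The second part is the graph induced on \<open>A \<union> B\<close>. It is cobipartite
  because \<open>A\<close> and \<open>B\<close> are cliques, and it meets \<open>G\<close> exactly
  in \<open>A\<close>.\<close>

lemma glued_attach:
  assumes "glued_from_cobipartite G"
  shows "glued_from_cobipartite G'"
proof (rule glued_from_cobipartite.glue[OF assms])
  define H where "H = \<lparr> pverts = A \<union> B, parcs = parcs G' \<inter> (A \<union> B) \<times> (A \<union> B) \<rparr>"
  have H: "simple_graph H"
    using simple_attach free_old finite_subset[OF A_subset] finite_B simple
    by (auto simp: simple_graph_iff H_def sym_def irrefl_def)
  have "bipartite (complement_graph H)"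
    unfolding bipartite_def
  proof (rule conjI[OF _ exI[of _ A, OF exI[of _ B]]]; (intro conjI allI impI)?)
    show "simple_graph (complement_graph H)"
      using H by (auto simp: complement_graph_def simple_graph_iff sym_def irrefl_def)
    show "A \<inter> B = {}" using fresh A_subset by auto
    fix u v assume "u \<rightarrow>\<^bsub>with_proj (complement_graph H)\<^esub> v"
    then have uv: "u \<in> A \<union> B" "v \<in> A \<union> B" "u \<noteq> v" "(u, v) \<notin> parcs G'"
      by (auto simp: complement_graph_def H_def)
    show "u \<in> A \<longleftrightarrow> v \<in> B"
    proof
      assume "u \<in> A"
      show "v \<in> B"
      proof (rule ccontr)
        assume "v \<notin> B"
        then have "v \<in> A" using uv by blast
        then show False using uv \<open>u \<in> A\<close> is_clique_arc[OF clique_attach_old[OF clique]] by blast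
      qed
    next
      assume "v \<in> B"
      then show "u \<in> A" using uv arc_new_iff by blast
    qed
  qed (simp add: complement_graph_def H_def)
  then show "glued_from_cobipartite H"
    using H by (intro glued_from_cobipartite.cobipartite) (simp add: cobipartite_def)
  have wf: "wf_digraph (with_proj K)" if "simple_graph K" for K :: "'a pair_pre_digraph"
    using that by (auto simp: simple_graph_iff wf_digraph_def)
  have int: "pverts G \<inter> pverts H = A" using A_subset fresh by (auto simp: H_def)
  show "glued_along_clique G H G'"
    unfolding glued_along_clique_def
  proof (rule conjI[OF _ exI[of _ G, OF exI[of _ H]]]; (intro conjI ballI)?)
    show "induced_subgraph (with_proj G) (with_proj G')"
    proof -
      have "parcs G = parcs G' \<inter> pverts G \<times> pverts G"
        using simple arc_old_iff unfolding simple_graph_iff by blast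
      then show ?thesis
        using simple simple_attach by (simp add: induced_subgraph_with_proj_iff)
    qed
    show "induced_subgraph (with_proj H) (with_proj G')"
      using H simple_attach A_subset by (subst induced_subgraph_with_proj_iff) (auto simp: H_def)
    show "is_clique G' (pverts G \<inter> pverts H)"
      using int clique clique_attach_old by simp
    fix u v assume "u \<in> pverts G - pverts H" "v \<in> pverts H - pverts G"
    then have "u \<in> pverts G" "u \<notin> A" "v \<in> B" using A_subset by (auto simp: H_def)
    then show "\<not> u \<rightarrow>\<^bsub>with_proj G'\<^esub> v" using arc_mixed_iff(1)[of u v] by simp
  qed (use simple_attach simple H wf digraph_iso_refl A_subset in \<open>auto simp: H_def\<close>)
qed

text \<open>The extension step for perfection: \<open>W\<close> is the vertex set of an induced
  subgraph and \<open>n\<close> bounds its cliques. The colors on old vertices are kept, and Hall's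
  theorem selects distinct colors for the new ones.\<close>

lemma proper_coloring_attach:
  fixes n :: nat
  assumes W: "W \<subseteq> pverts G'"
    and \<omega>: "\<And>K. is_clique G' K \<Longrightarrow> K \<subseteq> W \<Longrightarrow> card K \<le> n"
    and \<phi>: "\<phi> ` (W \<inter> pverts G) \<subseteq> {1..n}"
      "\<And>u v. u \<in> W \<Longrightarrow> v \<in> W \<Longrightarrow> (u, v) \<in> parcs G \<Longrightarrow> \<phi> u \<noteq> \<phi> v"
  shows "\<exists>\<psi>. \<psi> ` W \<subseteq> {1..n} \<and> (\<forall>u\<in>W. \<forall>v\<in>W. (u, v) \<in> parcs G' \<longrightarrow> \<psi> u \<noteq> \<psi> v)"
proof -
  \<comment> \<open>Hall's condition for the colors available in \<open>B\<close>: a set \<open>Y \<subseteq> B\<close> together with its common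
    neighbors \<open>D\<close> in \<open>A\<close> is a clique, and \<open>Y\<close> misses only the colors of \<open>D\<close>.\<close>
  define allowed where "allowed b = {1..n} - \<phi> ` {a \<in> A \<inter> W. b \<in> nb a}" for b
  have finA: "finite A" using A_subset simple finite_subset by (auto simp: simple_graph_iff)
  have inj: "inj_on \<phi> (A \<inter> W)"
    using clique \<phi>(2) unfolding inj_on_def is_clique_iff by (metis IntE)
  have "\<exists>f. inj_on f (W \<inter> B) \<and> (\<forall>b\<in>W \<inter> B. f b \<in> allowed b)"
  proof (rule hall)
    show "finite (W \<inter> B)" using finite_B by simp
    fix Y assume Y: "Y \<subseteq> W \<inter> B"
    show "card Y \<le> card (\<Union>(allowed ` Y))"
    proof (cases "Y = {}")
      case False
      define D where "D = {a \<in> A \<inter> W. Y \<subseteq> nb a}"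
      have D: "D \<subseteq> A \<inter> W" "finite D" using finA by (auto simp: D_def)
      have "is_clique G D" using clique D is_clique_mono by blast
      moreover have "(D \<union> Y) \<inter> pverts G = D" "(D \<union> Y) \<inter> B = Y"
        using D Y fresh A_subset by auto
      ultimately have "is_clique G' (D \<union> Y)"
        using D Y A_subset unfolding clique_attach_iff by (auto simp: D_def)
      then have "card (D \<union> Y) \<le> n" using D Y by (intro \<omega>) auto
      moreover have "D \<inter> Y = {}" using D Y A_subset fresh by blast
      moreover have "finite Y" using Y finite_B finite_subset by blast
      ultimately have "card D + card Y \<le> n" using D by (simp add: card_Un_disjoint)
      moreover have "{1..n} - \<phi> ` D \<subseteq> \<Union>(allowed ` Y)"
      proof
        fix c assume c: "c \<in> {1..n} - \<phi> ` D"
        show "c \<in> \<Union>(allowed ` Y)"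
        proof (rule ccontr)
          assume "c \<notin> \<Union>(allowed ` Y)"
          then have *: "\<forall>b\<in>Y. \<exists>a\<in>A \<inter> W. b \<in> nb a \<and> \<phi> a = c"
            using c by (auto simp: allowed_def)
          then obtain a where a: "a \<in> A \<inter> W" "\<phi> a = c" using False by blast
          \<comment> \<open>The color \<open>c\<close> occurs only once on the clique
            \<open>A \<inter> W\<close>, so the same \<open>a\<close> is the neighbor of color
            \<open>c\<close> for every \<open>b\<close> in \<open>Y\<close>.\<close>
          have "Y \<subseteq> nb a" using * a inj by (metis inj_onD subsetI)
          then have "a \<in> D" using a by (simp add: D_def)
          then show False using c a by blast
        qed
      qed
      then have "card ({1..n} - \<phi> ` D) \<le> card (\<Union>(allowed ` Y))"
        by (rule card_mono[rotated]) (auto simp: allowed_def intro: finite_subset[of _ "{1..n}"])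
      moreover have "n - card (\<phi> ` D) \<le> card ({1..n} - \<phi> ` D)"
        using diff_card_le_card_Diff[of "\<phi> ` D" "{1..n}"] D by simp
      moreover have "card (\<phi> ` D) \<le> card D" using D card_image_le by blast
      ultimately show ?thesis by linarith
    qed simp
  qed (simp add: allowed_def)
  then obtain f where f: "inj_on f (W \<inter> B)" "\<forall>b\<in>W \<inter> B. f b \<in> allowed b" by blast
  define \<psi> where "\<psi> v = (if v \<in> B then f v else \<phi> v)" for v
  have mixed: "\<psi> u \<noteq> \<psi> b" if "u \<in> A" "u \<in> W" "b \<in> nb u" "b \<in> W" for u b
  proof -
    have "b \<in> B" "u \<notin> B" using that nb A_subset fresh by auto
    moreover have "f b \<in> allowed b" using f that \<open>b \<in> B\<close> by blast
    moreover have "\<phi> u \<in> \<phi> ` {a \<in> A \<inter> W. b \<in> nb a}" using that by blast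
    ultimately show ?thesis unfolding \<psi>_def allowed_def by auto
  qed
  have "\<psi> u \<noteq> \<psi> v" if uv: "u \<in> W" "v \<in> W" "(u, v) \<in> parcs G'" for u v
  proof -
    have "u \<in> pverts G \<or> u \<in> B" "v \<in> pverts G \<or> v \<in> B" using W uv by auto
    moreover have ?thesis if "u \<in> pverts G" "v \<in> pverts G"
    proof -
      have "u \<notin> B" "v \<notin> B" using that fresh by blast+
      then show ?thesis using that uv \<phi>(2) arc_old_iff by (simp add: \<psi>_def)
    qed
    moreover have ?thesis if "u \<in> B" "v \<in> B"
    proof -
      have "u \<noteq> v" using that uv arc_new_iff by blast
      then show ?thesis using that uv inj_onD[OF f(1), of u v] by (auto simp: \<psi>_def)
    qed
    moreover have ?thesis if "u \<in> pverts G" "v \<in> B"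
      using that uv mixed arc_mixed_iff by blast
    moreover have ?thesis if "u \<in> B" "v \<in> pverts G"
      using that uv mixed arc_mixed_iff by metis
    ultimately show ?thesis by blast
  qed
  moreover have "\<psi> ` W \<subseteq> {1..n}"
  proof
    fix c assume "c \<in> \<psi> ` W"
    then obtain v where v: "v \<in> W" "c = \<psi> v" by blast
    show "c \<in> {1..n}"
    proof (cases "v \<in> B")
      case True
      then have "f v \<in> allowed v" using f(2) v by blast
      then show ?thesis using True v by (simp add: \<psi>_def allowed_def)
    next
      case False
      then have "v \<in> W \<inter> pverts G" using W v by auto
      then show ?thesis using False v \<phi>(1) by (auto simp: \<psi>_def)
    qed
  qed
  ultimately show ?thesis by blast
qed

end

section \<open>Unavoidable antichains\<close>

text \<open>Families are indexed by colors. In each coloring of \<open>B\<close>, some class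
  \<open>d\<close> contains a member of its own family, which will exclude \<open>d\<close> from the
  colors already frequent on the old clique. The set \<open>S\<close> in that class will form the
  next clique together with the old vertices whose sets contain it.\<close>

definition unavoidable_antichains ::
    "nat \<Rightarrow> nat \<Rightarrow> 'a set \<Rightarrow> (nat \<Rightarrow> 'a set set) \<Rightarrow> bool" where
  "unavoidable_antichains k N B F \<longleftrightarrow>
    (\<forall>c\<in>{1..k}. F c \<subseteq> Pow B - {{}}) \<and>
    (\<forall>c\<in>{1..k}. \<forall>d\<in>{1..k}. \<forall>X\<in>F c. \<forall>Y\<in>F d. X \<subseteq> Y \<longrightarrow> c = d \<and> X = Y) \<and>
    (\<forall>\<phi>. \<phi> ` B \<subseteq> {1..k} \<longrightarrow> (\<exists>d\<in>{1..k}. \<exists>S. S \<subseteq> {x \<in> B. \<phi> x = d} \<and> card S = N \<and>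
      (\<exists>X\<in>F d. X \<subseteq> {x \<in> B. \<phi> x = d}) \<and> (\<forall>c\<in>{1..k}. N \<le> card {X \<in> F c. S \<subseteq> X})))"

text \<open>A color class with \<open>m\<close> elements in one row and \<open>k\<close> elements
  elsewhere contains a set with any required split between the row and its outside, in particular a
  member of its own family. An \<open>N\<close>-subset of that row extends in many ways to a member
  of each family.\<close>

lemma unavoidable_antichains_exist:
  fixes k N :: nat
  assumes k: "k \<ge> 2" and N: "N \<ge> 1"
  shows "\<exists>K. \<forall>B :: 'a set. finite B \<longrightarrow> card B = K \<longrightarrow> (\<exists>F. unavoidable_antichains k N B F)"
proof -
  \<comment> \<open>\<open>B\<close> is a grid of \<open>R\<close> rows of length \<open>L\<close>, and \<open>F c\<close> consists of the \<open>m\<close>-subsets with exactly \<open>m - c\<close>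
    elements in some row; since \<open>m > 2 * k\<close> this is a majority row, hence determines \<open>c\<close>.\<close>
  define m R L where "m = N + 2 * k + 1" and "R = 2 * k" and "L = k * m"
  have kL: "2 * m \<le> L" using k by (simp add: L_def)
  have km: "k \<le> L" by (simp add: L_def m_def)
  show ?thesis
  proof (intro exI[of _ "R * L"] allI impI)
    fix B :: "'a set" assume B: "finite B" "card B = R * L"
    have "card ({..<R} \<times> {..<L}) = card B" using B by (simp add: card_cartesian_product)
    then obtain h where h: "bij_betw h ({..<R} \<times> {..<L}) B"
      using B finite_same_card_bij[of "{..<R} \<times> {..<L}" B] by auto
    define row where "row r = h ` ({r} \<times> {..<L})" for r
    have inj_h: "inj_on h ({..<R} \<times> {..<L})" and B_eq: "B = h ` ({..<R} \<times> {..<L})"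
      using h by (auto simp: bij_betw_def)
    have rowB: "row r \<subseteq> B" if "r < R" for r
      using that by (auto simp: row_def B_eq)
    have fin_row: "finite (row r)" for r by (simp add: row_def)
    have card_row: "card (row r) = L" if "r < R" for r
    proof -
      have "inj_on h ({r} \<times> {..<L})" using inj_h that by (auto intro: inj_on_subset)
      then show ?thesis by (simp add: row_def card_image card_cartesian_product)
    qed
    have disj: "row r \<inter> row s = {}" if "r < R" "s < R" "r \<noteq> s" for r s
      using that inj_h unfolding row_def inj_on_def by fastforce
    have B_rows: "B = (\<Union>r<R. row r)" unfolding B_eq row_def by blast
    define F where
      "F c = {X. X \<subseteq> B \<and> card X = m \<and> (\<exists>r<R. card (X \<inter> row r) = m - c)}" for c
    have antichain: "c = d \<and> X = Y"
      if c: "c \<in> {1..k}" "d \<in> {1..k}" and XY: "X \<in> F c" "Y \<in> F d" "X \<subseteq> Y" for c d X Y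
    proof -
      have finY: "finite Y" using XY B finite_subset by (auto simp: F_def)
      have "X = Y" using card_subset_eq[OF finY] XY by (simp add: F_def)
      obtain r s where r: "r < R" "card (Y \<inter> row r) = m - c" and s: "s < R" "card (Y \<inter> row s) = m - d"
        using XY \<open>X = Y\<close> by (auto simp: F_def)
      have "r = s"
      proof (rule ccontr)
        assume "r \<noteq> s"
        then have "(Y \<inter> row r) \<inter> (Y \<inter> row s) = {}" using disj r s by blast
        then have "card (Y \<inter> row r) + card (Y \<inter> row s) = card (Y \<inter> row r \<union> Y \<inter> row s)"
          using finY by (simp add: card_Un_disjoint)
        also have "\<dots> \<le> card Y" using finY by (intro card_mono) auto
        finally show False using r s c XY by (auto simp: F_def m_def)
      qed
      then have "m - c = m - d" using r s by simp
      then show ?thesis using c \<open>X = Y\<close> by (auto simp: m_def)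
    qed
    have hit: "\<exists>d\<in>{1..k}. \<exists>S. S \<subseteq> {x \<in> B. \<phi> x = d} \<and> card S = N \<and>
        (\<exists>X\<in>F d. X \<subseteq> {x \<in> B. \<phi> x = d}) \<and> (\<forall>c\<in>{1..k}. N \<le> card {X \<in> F c. S \<subseteq> X})"
      if \<phi>: "\<phi> ` B \<subseteq> {1..k}" for \<phi>
    proof -
      define P where "P d = {x \<in> B. \<phi> x = d}" for d
      have finP: "finite (P d)" for d using B by (simp add: P_def)
      \<comment> \<open>Pigeonhole over the colors: \<open>B\<close> has
        \<open>R * L = k * (R * m)\<close> elements. Averaging over the \<open>R\<close> rows then
        yields a row with \<open>m\<close> elements of the class. As \<open>R * m = 2 * L\<close>
        and a row has only \<open>L\<close> elements, at least \<open>L\<close> of the class lie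
        outside that row.\<close>
      have "\<exists>d\<in>{1..k}. R * m \<le> card (P d)"
      proof (rule ccontr)
        assume "\<not> ?thesis"
        then have "(\<Sum>d\<in>{1..k}. card (P d)) < (\<Sum>d\<in>{1..k}. R * m)"
          using k by (intro sum_strict_mono) (auto simp: not_le)
        moreover have "(\<Sum>d\<in>{1..k}. card (P d)) = card (\<Union>d\<in>{1..k}. P d)"
          using finP by (subst card_UN_disjoint) (auto simp: P_def)
        moreover have "(\<Union>d\<in>{1..k}. P d) = B" using \<phi> by (auto simp: P_def)
        moreover have "R * L = k * (R * m)" by (simp add: L_def)
        ultimately show False using B(2) by simp
      qed
      then obtain d where d: "d \<in> {1..k}" "R * m \<le> card (P d)" by blast
      have "R > 0" using k by (simp add: R_def)
      have "\<exists>r<R. m \<le> card (P d \<inter> row r)"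
      proof (rule ccontr)
        assume "\<not> ?thesis"
        then have "(\<Sum>r<R. card (P d \<inter> row r)) < (\<Sum>r<R. m)"
          using \<open>R > 0\<close> by (intro sum_strict_mono) (auto simp: not_le lessThan_empty_iff)
        moreover have "(\<Sum>r<R. card (P d \<inter> row r)) = card (\<Union>r<R. P d \<inter> row r)"
          using finP disj by (subst card_UN_disjoint) auto
        moreover have "(\<Union>r<R. P d \<inter> row r) = P d" using B_rows by (auto simp: P_def)
        ultimately show False using d by simp
      qed
      then obtain r where r: "r < R" "m \<le> card (P d \<inter> row r)" by blast
      have "card (P d) \<le> card (P d - row r) + card (row r)"
        using card_Un_le[of "P d - row r" "row r"] card_mono[of "P d \<union> row r" "P d"] finP fin_row
        by (metis Un_Diff_cancel2 Un_upper1 finite_UnI le_trans)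
      moreover have "R * m = 2 * L" by (simp add: R_def L_def)
      ultimately have out: "k \<le> card (P d - row r)" using d card_row[OF r(1)] km by linarith
      have split: "card (Y \<union> Z) = card Y + card Z \<and> (Y \<union> Z) \<inter> row r = Y"
        if YZ: "Y \<subseteq> row r" "Z \<subseteq> P d - row r" for Y Z
      proof
        have "finite Y" using YZ(1) fin_row by (rule finite_subset)
        moreover have "finite Z" using YZ(2) finP by (meson finite_Diff finite_subset)
        moreover have "Y \<inter> Z = {}" using YZ by blast
        ultimately show "card (Y \<union> Z) = card Y + card Z" by (rule card_Un_disjoint)
        show "(Y \<union> Z) \<inter> row r = Y" using YZ by blast
      qed
      have PB: "P d \<subseteq> B" by (auto simp: P_def)
      have "\<exists>X\<in>F d. X \<subseteq> P d"
      proof -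
        obtain Y where Y: "Y \<subseteq> P d \<inter> row r" "card Y = m - d"
        proof -
          have "m - d \<le> card (P d \<inter> row r)" using r(2) by simp
          then show ?thesis by (rule obtain_subset_with_card_n) (rule that)
        qed
        obtain Z where Z: "Z \<subseteq> P d - row r" "card Z = d"
        proof -
          have "d \<le> card (P d - row r)" using out d(1) by simp
          then show ?thesis by (rule obtain_subset_with_card_n) (rule that)
        qed
        have "Y \<union> Z \<in> F d" "Y \<union> Z \<subseteq> P d"
        proof -
          have "Y \<subseteq> row r" "Y \<subseteq> P d" "Z \<subseteq> P d" using Y Z by blast+
          then show "Y \<union> Z \<subseteq> P d" by blast
          then have "Y \<union> Z \<subseteq> B" using PB by blast
          moreover have "card (Y \<union> Z) = m" "(Y \<union> Z) \<inter> row r = Y"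
            using split[OF \<open>Y \<subseteq> row r\<close> Z(1)] Y(2) Z(2) d(1) by (simp_all add: m_def)
          ultimately show "Y \<union> Z \<in> F d" using Y(2) r(1) unfolding F_def by auto
        qed
        then show ?thesis by blast
      qed
      moreover obtain S where S: "S \<subseteq> P d \<inter> row r" "card S = N"
      proof -
        have "N \<le> card (P d \<inter> row r)" using r(2) by (simp add: m_def)
        then show ?thesis by (rule obtain_subset_with_card_n) (rule that)
      qed
      \<comment> \<open>Fix \<open>c\<close> elements \<open>Z\<close> outside the row and
        \<open>m - c - 1\<close> elements \<open>Y\<close> of the row that include \<open>S\<close>.
        Each further element of the row completes \<open>Y \<union> Z\<close> to a different member
        of \<open>F c\<close>. There are \<open>L - (m - c - 1)\<close> such elements, which is more
        than \<open>m\<close> because \<open>2 * m \<le> L\<close>.\<close>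
      moreover have "N \<le> card {X \<in> F c. S \<subseteq> X}" if c: "c \<in> {1..k}" for c
      proof -
        obtain Z where Z: "Z \<subseteq> P d - row r" "card Z = c"
        proof -
          have "c \<le> card (P d - row r)" using out c by simp
          then show ?thesis by (rule obtain_subset_with_card_n) (rule that)
        qed
        have "N \<le> m - c - 1" "m - c - 1 \<le> card (row r)"
          using c card_row[OF r(1)] kL by (auto simp: m_def)
        then obtain Y where Y: "S \<subseteq> Y" "Y \<subseteq> row r" "card Y = m - c - 1"
        proof -
          have "card S \<le> m - c - 1" "S \<subseteq> row r" using S \<open>N \<le> m - c - 1\<close> by simp_all
          then show ?thesis
            using exists_subset_between[of S "m - c - 1" "row r"] fin_row
              \<open>m - c - 1 \<le> card (row r)\<close> that by metis
        qed
        have finYZ: "finite Y" "finite Z"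
          using finite_subset[OF Y(2) fin_row] finite_subset[OF Z(1)] finP by simp_all
        let ?f = "\<lambda>y. insert y (Y \<union> Z)"
        have "?f ` (row r - Y) \<subseteq> {X \<in> F c. S \<subseteq> X}"
        proof
          fix X assume "X \<in> ?f ` (row r - Y)"
          then obtain y where "y \<in> row r - Y" "X = ?f y" by blast
          then have y: "y \<in> row r" "y \<notin> Y" "X = insert y Y \<union> Z" by simp_all
          have "card X = card (insert y Y) + card Z" "X \<inter> row r = insert y Y"
            using split[of "insert y Y" Z] y Y Z(1) by auto
          moreover have "card (insert y Y) = m - c"
            using y(2) Y(3) finYZ c by (simp add: m_def Suc_diff_le)
          moreover have "X \<subseteq> B"
          proof -
            have "insert y Y \<subseteq> B" using y(1) Y(2) rowB[OF r(1)] by blast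
            moreover have "Z \<subseteq> B" using Z(1) PB by blast
            ultimately show ?thesis using y(3) by simp
          qed
          moreover have "card X = m" using calculation Z(2) c y(3) by (simp add: m_def)
          ultimately have "X \<in> F c" using r(1) unfolding F_def by auto
          then show "X \<in> {X \<in> F c. S \<subseteq> X}" using y(3) Y(1) by auto
        qed
        moreover have "inj_on ?f (row r - Y)"
        proof (rule inj_onI)
          fix x y assume xy: "x \<in> row r - Y" "y \<in> row r - Y" "?f x = ?f y"
          then have "x \<in> ?f y" by (metis insertI1)
          moreover have "x \<notin> Y \<union> Z" using xy(1) Z(1) by blast
          ultimately show "x = y" by blast
        qed
        moreover have "finite {X \<in> F c. S \<subseteq> X}"
          using B by (auto simp: F_def intro: finite_subset[of _ "Pow B"])
        ultimately have "card (row r - Y) \<le> card {X \<in> F c. S \<subseteq> X}"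
          by (metis card_image card_mono)
        moreover have "card (row r - Y) = L - (m - c - 1)"
          using Y card_row[OF r(1)] finYZ by (simp add: card_Diff_subset)
        ultimately show ?thesis using kL by (simp add: m_def)
      qed
      ultimately show ?thesis using d(1) unfolding P_def by blast
    qed
    have "unavoidable_antichains k N B F"
      unfolding unavoidable_antichains_def
    proof (intro conjI)
      show "\<forall>c\<in>{1..k}. F c \<subseteq> Pow B - {{}}" by (auto simp: F_def m_def)
    qed (use antichain hit in blast)+
    then show "\<exists>F. unavoidable_antichains k N B F" by blast
  qed
qed

section \<open>Graphs built by attaching cliques\<close>

definition attaches :: "'a pair_pre_digraph \<Rightarrow> 'a pair_pre_digraph \<Rightarrow> bool" where
  "attaches G G' \<longleftrightarrow> (\<exists>A B nb. clique_attachment G A B nb \<and> G' = attach_clique G A B nb)"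

definition single_vertex :: "nat pair_pre_digraph" where
  "single_vertex = \<lparr> pverts = {0}, parcs = {} \<rparr>"

text \<open>Natural numbers as vertices leave an infinite supply of fresh vertices for every further
  attachment.\<close>

definition clique_tree :: "nat pair_pre_digraph \<Rightarrow> bool" where
  "clique_tree G \<longleftrightarrow> attaches\<^sup>*\<^sup>* single_vertex G"

lemma simple_single_vertex: "simple_graph single_vertex"
  by (simp add: simple_graph_iff single_vertex_def sym_def irrefl_def)

lemma clique_tree_simple: "clique_tree G \<Longrightarrow> simple_graph G"
  unfolding clique_tree_def
  by (induction rule: rtranclp_induct)
     (auto simp: simple_single_vertex attaches_def clique_attachment.simple_attach)

lemma clique_tree_glued: 
  assumes "clique_tree G"
  shows "glued_from_cobipartite G"
  using assms unfolding clique_tree_def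
proof (induction rule: rtranclp_induct)
  case base
  have "simple_graph (complement_graph single_vertex)"
    using simple_single_vertex
    by (auto simp: simple_graph_iff complement_graph_def sym_def irrefl_def)
  then have "bipartite (complement_graph single_vertex)"
    unfolding bipartite_def
    by (intro conjI exI[where x = "{}"] exI[where x = "{0}"] exI)
       (auto simp: complement_graph_def single_vertex_def)
  then show ?case
    using simple_single_vertex by (intro glued_from_cobipartite.cobipartite) (simp add: cobipartite_def)
qed (auto simp: attaches_def clique_attachment.glued_attach)

text \<open>Speaking of vertex sets \<open>W\<close> instead of induced subgraphs lets the induction
  pass to \<open>W \<inter> pverts G\<close>; the bound on cliques is inherited since cliques of
  \<open>G\<close> remain cliques.\<close>

lemma clique_tree_proper_coloring:
  fixes n :: nat
  assumes "clique_tree G" "W \<subseteq> pverts G" "\<And>K. is_clique G K \<Longrightarrow> K \<subseteq> W \<Longrightarrow> card K \<le> n"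
  shows "\<exists>\<psi>. \<psi> ` W \<subseteq> {1..n} \<and> (\<forall>u\<in>W. \<forall>v\<in>W. (u, v) \<in> parcs G \<longrightarrow> \<psi> u \<noteq> \<psi> v)"
  using assms unfolding clique_tree_def
proof (induction arbitrary: W rule: rtranclp_induct)
  case base
  have W: "W \<subseteq> {0}" using base by (simp add: single_vertex_def)
  then have "is_clique single_vertex W" by (auto simp: is_clique_iff single_vertex_def)
  then have "card W \<le> n" using base(2) by blast
  moreover have "W = {} \<or> W = {0}" using W by blast
  ultimately have "W = {} \<or> n \<ge> 1" by auto
  then show ?case by (intro exI[of _ "\<lambda>_. 1"]) (auto simp: single_vertex_def)
next
  case (step G G')
  then obtain A B nb where att: "clique_attachment G A B nb" and G': "G' = attach_clique G A B nb"
    by (auto simp: attaches_def)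
  interpret clique_attachment G A B nb by (rule att)
  have simpG: "parcs G \<subseteq> pverts G \<times> pverts G" using simple by (simp add: simple_graph_iff)
  obtain \<phi> where \<phi>: "\<phi> ` (W \<inter> pverts G) \<subseteq> {1..n}"
    "\<forall>u\<in>W \<inter> pverts G. \<forall>v\<in>W \<inter> pverts G. (u, v) \<in> parcs G \<longrightarrow> \<phi> u \<noteq> \<phi> v"
    using step.IH[of "W \<inter> pverts G"] step.prems(2) clique_attach_old unfolding G'
    by (metis inf_le2 le_inf_iff)
  show ?case
    unfolding G'
    by (rule proper_coloring_attach[OF _ _ \<phi>(1)])
       (use step.prems \<phi>(2) simpG in \<open>auto simp: G'\<close>)
qed

text \<open>The preceding coloring with \<open>n\<close> equal to the clique number gives the upper
  bound; a largest clique needs pairwise distinct colors and gives the lower bound.\<close>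

lemma clique_tree_perfect:
  assumes "clique_tree G"
  shows "perfect G"
  unfolding perfect_def
proof (intro conjI allI impI; (elim conjE)?)
  show G: "simple_graph G" using assms by (rule clique_tree_simple)
  fix H assume H: "simple_graph H" "induced_subgraph (with_proj H) (with_proj G)"
  then have sub: "pverts H \<subseteq> pverts G" "parcs H = parcs G \<inter> pverts H \<times> pverts H"
    using G by (simp_all add: induced_subgraph_with_proj_iff)
  have cliques: "is_clique H K \<longleftrightarrow> is_clique G K \<and> K \<subseteq> pverts H" for K
    using sub by (auto simp: is_clique_iff)
  have fin: "finite {K. is_clique H K}"
  proof (rule finite_subset)
    show "{K. is_clique H K} \<subseteq> Pow (pverts H)" by (auto simp: is_clique_iff)
    show "finite (Pow (pverts H))" using H(1) by (simp add: simple_graph_iff)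
  qed
  have le: "card K \<le> clique_number H" if "is_clique H K" for K
    unfolding clique_number_def using fin that by (intro Max_ge finite_imageI imageI) simp_all
  have "is_clique H {}" by (simp add: is_clique_iff)
  then have "clique_number H \<in> card ` {K. is_clique H K}"
    unfolding clique_number_def using fin by (intro Max_in) blast+
  then obtain K where K: "clique_number H = card K" "K \<in> {K. is_clique H K}" by (rule imageE)
  then have clK: "is_clique H K" by simp
  show "chromatic_number H = clique_number H"
    unfolding chromatic_number_def
  proof (rule Least_equality)
    obtain \<psi> where "\<psi> ` pverts H \<subseteq> {1..clique_number H}"
      "\<forall>u\<in>pverts H. \<forall>v\<in>pverts H. (u, v) \<in> parcs G \<longrightarrow> \<psi> u \<noteq> \<psi> v"
      using clique_tree_proper_coloring[OF assms sub(1), of "clique_number H"] le cliques by metis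
    then show "colorable H (clique_number H)"
      using sub(2) unfolding colorable_def proper_coloring_def
      by (intro exI[of _ \<psi>]) simp
  next
    fix n assume "colorable H n"
    then obtain \<psi> :: "nat \<Rightarrow> nat" where \<psi>: "\<psi> ` pverts H \<subseteq> {1..n}" "proper_coloring H \<psi>"
      unfolding colorable_def by blast
    have "inj_on \<psi> K"
      using clK \<psi>(2) unfolding inj_on_def proper_coloring_def is_clique_def by blast
    moreover have "\<psi> ` K \<subseteq> {1..n}" using clK \<psi>(1) unfolding is_clique_iff by blast
    ultimately show "clique_number H \<le> n"
      using K(1) card_inj_on_le[of \<psi> K "{1..n}"] by simp
  qed
qed

lemma clique_tree_exact_chromatic_number:
  assumes "clique_tree G" "\<not> clique_colorable G k" "k \<ge> 1"
  shows "\<exists>G'. clique_tree G' \<and> clique_chromatic_number G' = k + 1"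
proof -
  \<comment> \<open>Discrete intermediate values: an attachment raises the clique-chromatic number by at most one.\<close>
  have mono: "clique_colorable H j \<Longrightarrow> j \<le> i \<Longrightarrow> clique_colorable H i" for H :: "nat pair_pre_digraph" and i j
    unfolding clique_colorable_def by (meson atLeastatMost_subset_iff order.trans order_refl)
  from assms(1) have "clique_colorable G k \<or> ?thesis"
    unfolding clique_tree_def
  proof (induction rule: rtranclp_induct)
    case base
    have "\<not> (maximal_clique single_vertex S \<and> card S \<ge> 2)" for S
      using card_mono[of "{0}" S] by (auto simp: maximal_clique_def is_clique_iff single_vertex_def)
    then have "clique_colorable single_vertex k"
      using assms(3) unfolding clique_colorable_def clique_coloring_def
      by (intro exI[of _ "\<lambda>_. 1"]) (auto simp: single_vertex_def)
    then show ?case ..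
  next
    case (step H H')
    then obtain A B nb where att: "clique_attachment H A B nb" and H': "H' = attach_clique H A B nb"
      by (auto simp: attaches_def)
    show ?case
    \<comment> \<open>The attachment at which \<open>k\<close> colors cease to suffice is the one
      where the value is exactly \<open>k + 1\<close>.\<close>
    proof (cases "clique_colorable H k \<and> \<not> clique_colorable H' k")
      case True
      then have "clique_colorable H' (k + 1)"
        using clique_attachment.clique_colorable_attach[OF att] assms(3) by (simp add: H')
      then have "clique_chromatic_number H' = k + 1"
        unfolding clique_chromatic_number_def
        using True mono by (intro Least_equality) (auto simp: not_less_eq_eq[symmetric])
      moreover have "clique_tree H'"
        using step.hyps unfolding clique_tree_def by (rule rtranclp.rtrancl_into_rtrancl)
      ultimately show ?thesis unfolding clique_tree_def by blast
    next
      case False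
      then show ?thesis using step.IH by blast
    qed
  qed
  then show ?thesis using assms(2) by blast
qed

section \<open>Forcing many colors on one clique\<close>

definition k_clique_coloring :: "'a pair_pre_digraph \<Rightarrow> nat \<Rightarrow> ('a \<Rightarrow> nat) \<Rightarrow> bool" where
  "k_clique_coloring G k \<phi> \<longleftrightarrow> \<phi> ` pverts G \<subseteq> {1..k} \<and> clique_coloring G \<phi>"

text \<open>The condition \<open>Q \<noteq> {}\<close> matters for \<open>j = 0\<close>: the next
  attachment needs an old vertex without new neighbors, and an empty \<open>C\<close> supplies none.
  For \<open>j = k + 1\<close> no such clique can exist.\<close>

definition rich_clique :: "'a pair_pre_digraph \<Rightarrow> nat \<Rightarrow> ('a \<Rightarrow> nat) \<Rightarrow> nat \<Rightarrow> nat \<Rightarrow> bool" where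
  "rich_clique G k \<phi> j N \<longleftrightarrow> (\<exists>Q C. is_clique G Q \<and> Q \<noteq> {} \<and> C \<subseteq> {1..k} \<and> card C = j \<and>
     (\<forall>c\<in>C. N \<le> card {q \<in> Q. \<phi> q = c}))"

lemma attaches_mono:
  assumes "attaches G G'"
  shows "pverts G \<subseteq> pverts G'" "is_clique G S \<Longrightarrow> is_clique G' S"
    "k_clique_coloring G' k \<phi> \<Longrightarrow> k_clique_coloring G k \<phi>"
proof -
  obtain A B nb where att: "clique_attachment G A B nb" and G': "G' = attach_clique G A B nb"
    using assms by (auto simp: attaches_def)
  show "pverts G \<subseteq> pverts G'"
    by (simp add: G' clique_attachment.pverts_attach[OF att])
  then show "k_clique_coloring G' k \<phi> \<Longrightarrow> k_clique_coloring G k \<phi>"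
    using clique_attachment.clique_coloring_attachD[OF att] G' unfolding k_clique_coloring_def by blast
  show "is_clique G S \<Longrightarrow> is_clique G' S"
    unfolding G' by (rule clique_attachment.clique_attach_old[OF att])
qed

lemma rtranclp_attaches_mono:
  assumes "attaches\<^sup>*\<^sup>* G G'"
  shows "pverts G \<subseteq> pverts G'" "is_clique G S \<Longrightarrow> is_clique G' S"
    "k_clique_coloring G' k \<phi> \<Longrightarrow> k_clique_coloring G k \<phi>"
proof -
  have "pverts G \<subseteq> pverts G' \<and> (is_clique G S \<longrightarrow> is_clique G' S) \<and>
    (k_clique_coloring G' k \<phi> \<longrightarrow> k_clique_coloring G k \<phi>)"
    using assms
  proof (induction rule: rtranclp_induct)
    case (step H H')
    show ?case
      using step.IH attaches_mono(1)[OF step.hyps(2)] attaches_mono(2)[OF step.hyps(2), of S]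
        attaches_mono(3)[OF step.hyps(2), of k \<phi>]
      by blast
  qed simp
  then show "pverts G \<subseteq> pverts G'" "is_clique G S \<Longrightarrow> is_clique G' S"
    "k_clique_coloring G' k \<phi> \<Longrightarrow> k_clique_coloring G k \<phi>"
    by simp_all
qed

lemma rich_clique_mono:
  assumes "attaches\<^sup>*\<^sup>* G G'" "rich_clique G k \<phi> j N"
  shows "rich_clique G' k \<phi> j N"
proof -
  obtain Q C where Q: "is_clique G Q" and QC: "Q \<noteq> {} \<and> C \<subseteq> {1..k} \<and> card C = j \<and>
      (\<forall>c\<in>C. N \<le> card {q \<in> Q. \<phi> q = c})"
    using assms(2) unfolding rich_clique_def by blast
  show ?thesis
    unfolding rich_clique_def
    by (intro exI[of _ Q] exI[of _ C] conjI[OF rtranclp_attaches_mono(2)[OF assms(1) Q]] QC)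
qed

text \<open>The coloring \<psi> of \<open>Q\<close> is prescribed because the new edges depend on
  it: the vertices of color \<open>c\<close> are matched with the members of
  \<open>F c\<close>.\<close>

lemma rich_clique_step:
  fixes k N :: nat
  assumes k: "k \<ge> 2" and N: "N \<ge> 1"
  shows "\<exists>M\<ge>1. \<forall>(G :: nat pair_pre_digraph) \<psi> Q C. simple_graph G \<longrightarrow> is_clique G Q \<longrightarrow> Q \<noteq> {} \<longrightarrow>
    C \<subseteq> {1..k} \<longrightarrow> (\<forall>c\<in>C. M \<le> card {q \<in> Q. \<psi> q = c}) \<longrightarrow>
    (\<exists>G'. attaches G G' \<and> (\<forall>\<phi>. k_clique_coloring G' k \<phi> \<longrightarrow> (\<forall>v\<in>Q. \<phi> v = \<psi> v) \<longrightarrow>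
      rich_clique G' k \<phi> (Suc (card C)) N))"
proof -
  obtain K where K: "\<forall>B :: nat set. finite B \<longrightarrow> card B = K \<longrightarrow> (\<exists>F. unavoidable_antichains k N B F)"
    using unavoidable_antichains_exist[OF k N] by (rule exE)
  show ?thesis
  \<comment> \<open>A family on a set of \<open>K\<close> elements has at most \<open>2 ^ K\<close>
    members. The additional vertex of each color stays unmatched and serves as the old vertex
    without new neighbors.\<close>
  proof (intro exI[of _ "Suc (2 ^ K)"] conjI allI impI)
    show "1 \<le> Suc (2 ^ K)" by simp
    fix G :: "nat pair_pre_digraph" and \<psi> Q C
    assume G: "simple_graph G" and Q: "is_clique G Q" "Q \<noteq> {}" and C: "C \<subseteq> {1..k}"
      and rich: "\<forall>c\<in>C. Suc (2 ^ K) \<le> card {q \<in> Q. \<psi> q = c}"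
    have finV: "finite (pverts G)" and QV: "Q \<subseteq> pverts G"
      using G Q by (simp_all add: simple_graph_iff is_clique_iff)
    then have finQ: "finite Q" using finite_subset by blast
    define s where "s = Suc (Max (pverts G))"
    have s: "v < s" if "v \<in> pverts G" for v
      using Max_ge[OF finV that] by (simp add: s_def)
    define B0 where "B0 = {s..<s + K}"
    have B0: "finite B0" "card B0 = K" by (simp_all add: B0_def)
    \<comment> \<open>The vertex \<open>s + K\<close> lies in no member of any family; it is the new
      vertex without old neighbors that an attachment requires.\<close>
    define B where "B = insert (s + K) B0"
    have B0B: "B0 \<subseteq> B" by (auto simp: B_def)
    have "v \<notin> pverts G" if "v \<in> B" for v
      using that s[of v] by (auto simp: B_def B0_def)
    then have BV: "B \<inter> pverts G = {}" by blast
    obtain F where "unavoidable_antichains k N B0 F" using K B0 by blast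
    then have F: "\<And>c. c \<in> {1..k} \<Longrightarrow> F c \<subseteq> Pow B0 - {{}}"
      and antichain: "\<And>c d X Y. c \<in> {1..k} \<Longrightarrow> d \<in> {1..k} \<Longrightarrow> X \<in> F c \<Longrightarrow> Y \<in> F d \<Longrightarrow> X \<subseteq> Y \<Longrightarrow>
        c = d \<and> X = Y"
      and hit: "\<And>\<phi>. \<phi> ` B0 \<subseteq> {1..k} \<Longrightarrow> \<exists>d\<in>{1..k}. \<exists>S. S \<subseteq> {x \<in> B0. \<phi> x = d} \<and> card S = N \<and>
        (\<exists>X\<in>F d. X \<subseteq> {x \<in> B0. \<phi> x = d}) \<and> (\<forall>c\<in>{1..k}. N \<le> card {X \<in> F c. S \<subseteq> X})"
      unfolding unavoidable_antichains_def by (elim conjE, simp only: Ball_def)+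
    have "\<forall>c\<in>C. \<exists>T f. T \<subset> {q \<in> Q. \<psi> q = c} \<and> bij_betw f T (F c)"
    proof
      fix c assume c: "c \<in> C"
      have "c \<in> {1..k}" using c C by (rule subsetD[rotated])
      from F[OF this] have sub: "F c \<subseteq> Pow B0" by blast
      then have finF: "finite (F c)" using B0(1) by (simp add: finite_subset)
      have "card (F c) \<le> 2 ^ K"
        using card_mono[OF _ sub] B0 by (simp add: card_Pow)
      then have less: "card (F c) < card {q \<in> Q. \<psi> q = c}" using rich c by fastforce
      then obtain T where T: "T \<subseteq> {q \<in> Q. \<psi> q = c}" "card T = card (F c)" "finite T"
        by (rule obtain_subset_with_card_n[OF less_imp_le])
      then obtain f where f: "bij_betw f T (F c)"
        using finite_same_card_bij[OF T(3) finF] by blast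
      have "T \<noteq> {q \<in> Q. \<psi> q = c}" using T(2) less by auto
      then show "\<exists>T f. T \<subset> {q \<in> Q. \<psi> q = c} \<and> bij_betw f T (F c)" using T(1) f by blast
    qed
    from bchoice[OF this] obtain T where "\<forall>c\<in>C. \<exists>f. T c \<subset> {q \<in> Q. \<psi> q = c} \<and> bij_betw f (T c) (F c)"
      by (rule exE)
    from bchoice[OF this] obtain f where
      "\<forall>c\<in>C. T c \<subset> {q \<in> Q. \<psi> q = c} \<and> bij_betw (f c) (T c) (F c)"
      by (rule exE)
    then have T: "\<And>c. c \<in> C \<Longrightarrow> T c \<subset> {q \<in> Q. \<psi> q = c}"
      and f: "\<And>c. c \<in> C \<Longrightarrow> bij_betw (f c) (T c) (F c)"
      by simp_all
    define nb where "nb q = (if \<psi> q \<in> C \<and> q \<in> T (\<psi> q) then f (\<psi> q) q else {})" for q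
    have nb_in: "nb q \<in> F c \<and> nb q = f c q \<and> \<psi> q = c" if "c \<in> C" "q \<in> T c" for c q
    proof -
      have "\<psi> q = c" using T that by blast
      moreover have "f c q \<in> F c" using f that by (auto simp: bij_betw_def)
      ultimately show ?thesis using that by (simp add: nb_def)
    qed
    have nb_cases: "\<psi> q \<in> C \<and> q \<in> T (\<psi> q)" if "nb q \<noteq> {}" for q
      using that by (auto simp: nb_def split: if_splits)
    have nb_sub: "nb q \<subseteq> B0" for q
    proof (cases "nb q = {}")
      case False
      then have "\<psi> q \<in> C" "nb q \<in> F (\<psi> q)" using nb_cases[of q] nb_in[of "\<psi> q" q] by blast+
      then show ?thesis using F[of "\<psi> q"] C by blast
    qed simp
    have att: "clique_attachment G Q B nb"
    proof
      show "\<exists>q\<in>Q. nb q = {}"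
      proof (cases "C = {}")
        case True
        then show ?thesis using Q by (auto simp: nb_def)
      next
        case False
        then obtain c where "c \<in> C" by blast
        then obtain q where "q \<in> Q" "\<psi> q = c" "q \<notin> T c" using T by blast
        then show ?thesis by (auto simp: nb_def)
      qed
      have "s + K \<notin> B0" by (simp add: B0_def)
      then show "\<exists>b\<in>B. \<forall>q\<in>Q. b \<notin> nb q" using nb_sub unfolding B_def by blast
      show "nb q \<subseteq> B" for q using nb_sub[of q] unfolding B_def by blast
    qed (use G Q B0 BV in \<open>simp_all add: B_def\<close>)
    interpret clique_attachment G Q B nb by (rule att)
    have S_clique: "is_clique G' (S \<union> R)"
      if S: "S \<subseteq> B0" and R: "R \<subseteq> Q" "\<forall>q\<in>R. S \<subseteq> nb q" for S R
    proof -
      have "(S \<union> R) \<inter> pverts G = R" "S \<subseteq> B" "R \<inter> B = {}"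
        using S R(1) QV BV B0B by blast+
      moreover have "is_clique G R" using Q(1) R(1) by (rule is_clique_mono)
      ultimately show ?thesis
        using R QV unfolding clique_attach_iff by (simp add: Int_Un_distrib2) blast
    qed
    have main: "rich_clique G' k \<phi> (Suc (card C)) N"
      if \<phi>: "k_clique_coloring G' k \<phi>" "\<forall>v\<in>Q. \<phi> v = \<psi> v" for \<phi>
    proof -
      have "B0 \<subseteq> pverts G'" using B0B by (simp add: le_supI2)
      then have "\<phi> ` B0 \<subseteq> {1..k}" using \<phi>(1) unfolding k_clique_coloring_def by blast
      from hit[OF this] obtain d S X where d: "d \<in> {1..k}"
        and S: "S \<subseteq> {x \<in> B0. \<phi> x = d}" "card S = N" "\<forall>c\<in>{1..k}. N \<le> card {X \<in> F c. S \<subseteq> X}"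
        and X: "X \<in> F d" "X \<subseteq> {x \<in> B0. \<phi> x = d}"
        by blast
      \<comment> \<open>Otherwise the vertex of \<open>Q\<close> with neighborhood \<open>X\<close> has color \<open>d\<close> too and forms a monochromatic
        maximal clique with \<open>X\<close>; maximality is the antichain property.\<close>
      have "d \<notin> C"
      proof
        assume dC: "d \<in> C"
        have "X \<in> f d ` T d" using bij_betw_imp_surj_on[OF f[OF dC]] X(1) by simp
        then obtain q where q: "q \<in> T d" "f d q = X" by blast
        have nbq: "nb q = X" "\<psi> q = d" using nb_in[OF dC q(1)] q(2) by metis+
        have qQ: "q \<in> Q" using T[OF dC] q(1) by blast
        have "X \<in> Pow B0 - {{}}" using F[OF d] X(1) by (rule subsetD)
        then have X': "X \<noteq> {}" "X \<subseteq> B0" by simp_all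
        have "maximal_clique G' (X \<union> {q})"
          unfolding maximal_clique_def
        proof (intro conjI allI impI; (elim conjE)?)
          show "is_clique G' (X \<union> {q})" using S_clique[of X "{q}"] nbq qQ X' by simp
          fix U assume U: "is_clique G' U" "X \<union> {q} \<subseteq> U"
          have "v \<in> X \<union> {q}" if v: "v \<in> U" for v
          proof (cases "v \<in> B")
            case True
            have "q \<in> U" "q \<in> pverts G" using U(2) qQ QV by blast+
            then have "v \<in> nb q" using clique_attach_mixed(2)[OF U(1) _ _ v True] by simp
            then show ?thesis using nbq by simp
          next
            case False
            then have "v \<in> pverts G" using U(1) v by (auto simp: is_clique_iff)
            then have "b \<in> nb v" if "b \<in> X" for b
              using clique_attach_mixed(2)[OF U(1) v] that U(2) X'(2) B0B by blast
            then have "X \<subseteq> nb v" by blast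
            then have v': "\<psi> v \<in> C" "v \<in> T (\<psi> v)" using nb_cases[of v] X'(1) by blast+
            have "d = \<psi> v \<and> X = nb v"
              using antichain[OF d subsetD[OF C v'(1)] X(1) _ \<open>X \<subseteq> nb v\<close>] nb_in[OF v'] by blast
            \<comment> \<open>The vertices \<open>v\<close> and \<open>q\<close> are matched with
              the same set, and the matching is injective.\<close>
            then have "f d v = f d q" "v \<in> T d" using nb_in[OF v'] v' q(2) by metis+
            then have "v = q" using f[OF dC] q(1) by (meson bij_betw_def inj_onD)
            then show ?thesis by simp
          qed
          then show "U = X \<union> {q}" using U(2) by blast
        qed
        moreover have "card (X \<union> {q}) \<ge> 2"
        proof -
          have "finite X" using X'(2) B0(1) by (rule finite_subset)
          moreover have "q \<notin> X" using qQ QV X'(2) BV B0B by blast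
          ultimately have "card (X \<union> {q}) = Suc (card X)" by simp
          moreover have "card X \<noteq> 0" using \<open>finite X\<close> X'(1) by simp
          ultimately show ?thesis by linarith
        qed
        moreover have "monochromatic \<phi> (X \<union> {q})"
        proof -
          have "\<phi> v = d" if "v \<in> X \<union> {q}" for v
            using that X(2) nbq(2) \<phi>(2) qQ by auto
          then show ?thesis by (simp add: monochromatic_def)
        qed
        ultimately show False using \<phi>(1) unfolding k_clique_coloring_def clique_coloring_def by blast
      qed
      \<comment> \<open>The next rich clique: \<open>S\<close> provides color \<open>d\<close>, and
        its common neighbors in \<open>Q\<close> provide each \<open>c\<close> in \<open>C\<close>,
        since \<open>f c\<close> matches the members of \<open>F c\<close> containing
        \<open>S\<close> with distinct vertices of color \<open>c\<close>.\<close>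
      let ?Q = "S \<union> {q \<in> Q. S \<subseteq> nb q}"
      have SB: "S \<subseteq> B0" using S(1) by blast
      have finS: "finite S" using SB B0(1) by (rule finite_subset)
      have finQ': "finite ?Q" using finS finQ by simp
      have "N \<le> card {q \<in> ?Q. \<phi> q = c}" if c: "c \<in> insert d C" for c
      proof (cases "c = d")
        case True
        then have "S \<subseteq> {q \<in> ?Q. \<phi> q = c}" using S(1) by blast
        then show ?thesis using card_mono[of "{q \<in> ?Q. \<phi> q = c}" S] finQ' S(2) by simp
      next
        case False
        then have cC: "c \<in> C" using c by simp
        let ?P = "{q \<in> T c. S \<subseteq> f c q}"
        have P: "?P \<subseteq> {q \<in> ?Q. \<phi> q = c}"
        proof
          fix q assume q: "q \<in> ?P"
          then have "q \<in> Q" using T[OF cC] by blast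
          moreover have "nb q = f c q" "\<psi> q = c" using q nb_in[OF cC, of q] by blast+
          ultimately show "q \<in> {q \<in> ?Q. \<phi> q = c}" using q \<phi>(2) by simp
        qed
        have "{X \<in> F c. S \<subseteq> X} = f c ` ?P"
          unfolding bij_betw_imp_surj_on[OF f[OF cC], symmetric] by blast
        moreover have "N \<le> card {X \<in> F c. S \<subseteq> X}" using S(3) subsetD[OF C cC] by blast
        ultimately have "N \<le> card (f c ` ?P)" by simp
        also have "\<dots> \<le> card ?P" using finite_subset[OF P] finQ' by (intro card_image_le) simp
        also have "\<dots> \<le> card {q \<in> ?Q. \<phi> q = c}" using finQ' by (intro card_mono[OF _ P]) simp
        finally show ?thesis .
      qed
      moreover have "is_clique G' ?Q" by (rule S_clique[OF SB]) auto
      moreover have "?Q \<noteq> {}" using S(2) N by fastforce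
      moreover have "card (insert d C) = Suc (card C)"
        using \<open>d \<notin> C\<close> finite_subset[OF C] by simp
      moreover have "insert d C \<subseteq> {1..k}" using C d by blast
      ultimately show ?thesis
        unfolding rich_clique_def
        by (intro exI[of _ ?Q] exI[of _ "insert d C"] conjI ballI)
    qed
    show "\<exists>G'. attaches G G' \<and> (\<forall>\<phi>. k_clique_coloring G' k \<phi> \<longrightarrow>
      (\<forall>v\<in>Q. \<phi> v = \<psi> v) \<longrightarrow> rich_clique G' k \<phi> (Suc (card C)) N)"
      using main att unfolding attaches_def by blast
  qed
qed

text \<open>Induction on \<open>j\<close> with \<open>N\<close> arbitrary: one more color costs
  multiplicity, so frequency \<open>N\<close> for \<open>j + 1\<close> colors is obtained from a
  larger frequency \<open>M\<close> for \<open>j\<close> colors.\<close>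

lemma rich_clique_unavoidable:
  fixes k N :: nat
  assumes k: "k \<ge> 2" and "N \<ge> 1"
  shows "\<exists>G. clique_tree G \<and> (\<forall>\<phi>. k_clique_coloring G k \<phi> \<longrightarrow> rich_clique G k \<phi> j N)"
  using assms(2)
proof (induction j arbitrary: N)
  case 0
  have "rich_clique single_vertex k \<phi> 0 N" for \<phi>
    unfolding rich_clique_def
    by (intro exI[of _ "{0}"] exI[of _ "{}"]) (simp add: is_clique_iff single_vertex_def)
  moreover have "clique_tree single_vertex" by (simp add: clique_tree_def)
  ultimately show ?case by blast
next
  case (Suc j)
  obtain M where M: "M \<ge> 1" and step: "\<And>(G :: nat pair_pre_digraph) \<psi> Q C. simple_graph G \<Longrightarrow>
    is_clique G Q \<Longrightarrow> Q \<noteq> {} \<Longrightarrow> C \<subseteq> {1..k} \<Longrightarrow> (\<forall>c\<in>C. M \<le> card {q \<in> Q. \<psi> q = c}) \<Longrightarrow>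
    (\<exists>G'. attaches G G' \<and> (\<forall>\<phi>. k_clique_coloring G' k \<phi> \<longrightarrow> (\<forall>v\<in>Q. \<phi> v = \<psi> v) \<longrightarrow>
      rich_clique G' k \<phi> (Suc (card C)) N))"
    using rich_clique_step[OF k Suc.prems] by blast
  obtain G where G: "clique_tree G" "\<And>\<phi>. k_clique_coloring G k \<phi> \<Longrightarrow> rich_clique G k \<phi> j M"
    using Suc.IH[OF M] by blast
  \<comment> \<open>The clique to attach depends on the coloring, so there is one attachment for each of the
    finitely many colorings of \<open>G\<close>; earlier maximal cliques stay maximal throughout.\<close>
  have ext: "\<exists>H. attaches\<^sup>*\<^sup>* G H \<and> (\<forall>\<phi>. k_clique_coloring H k \<phi> \<longrightarrow>
      restrict \<phi> (pverts G) \<in> \<Psi> \<longrightarrow> rich_clique H k \<phi> (Suc j) N)"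
    if "finite \<Psi>" for \<Psi>
    using that
  proof (induction \<Psi> rule: finite_induct)
    case (insert \<psi> \<Psi>)
    then obtain H where H: "attaches\<^sup>*\<^sup>* G H"
      "\<And>\<phi>. k_clique_coloring H k \<phi> \<Longrightarrow> restrict \<phi> (pverts G) \<in> \<Psi> \<Longrightarrow> rich_clique H k \<phi> (Suc j) N"
      by blast
    show ?case
    proof (cases "\<exists>\<phi>. k_clique_coloring H k \<phi> \<and> restrict \<phi> (pverts G) = \<psi>")
      case False
      then show ?thesis using H by blast
    next
      case True
      then obtain \<phi>0 where \<phi>0: "k_clique_coloring H k \<phi>0" "restrict \<phi>0 (pverts G) = \<psi>" by blast
      \<comment> \<open>The rich clique is taken in \<open>G\<close>, not in \<open>H\<close>: all
        colorings that restrict to \<psi> agree on it, so one attachment handles them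
        together.\<close>
      have "rich_clique G k \<phi>0 j M" using G(2) rtranclp_attaches_mono(3)[OF H(1) \<phi>0(1)] by blast
      then obtain Q C where Q: "is_clique G Q" "Q \<noteq> {}" and C: "C \<subseteq> {1..k}" "card C = j"
        and rich: "\<forall>c\<in>C. M \<le> card {q \<in> Q. \<phi>0 q = c}"
        unfolding rich_clique_def by blast
      have "clique_tree H" using G(1) H(1) unfolding clique_tree_def by (rule rtranclp_trans)
      then have "simple_graph H" by (rule clique_tree_simple)
      from step[OF this rtranclp_attaches_mono(2)[OF H(1) Q(1)] Q(2) C(1) rich] C(2)
      obtain H' where H': "attaches H H'" "\<And>\<phi>. k_clique_coloring H' k \<phi> \<Longrightarrow>
          \<forall>v\<in>Q. \<phi> v = \<phi>0 v \<Longrightarrow> rich_clique H' k \<phi> (Suc j) N"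
        by blast
      have "rich_clique H' k \<phi> (Suc j) N"
        if \<phi>: "k_clique_coloring H' k \<phi>" "restrict \<phi> (pverts G) \<in> insert \<psi> \<Psi>" for \<phi>
      proof (cases "restrict \<phi> (pverts G) = \<psi>")
        case True
        then have "\<phi> v = \<phi>0 v" if "v \<in> pverts G" for v
          using \<phi>0(2) that by (metis restrict_apply')
        then have "\<forall>v\<in>Q. \<phi> v = \<phi>0 v" using Q(1) by (auto simp: is_clique_iff)
        then show ?thesis by (rule H'(2)[OF \<phi>(1)])
      next
        case False
        then have "rich_clique H k \<phi> (Suc j) N"
          using H(2) attaches_mono(3)[OF H'(1) \<phi>(1)] \<phi>(2) by blast
        then show ?thesis using H'(1) by (blast intro: rich_clique_mono)
      qed
      moreover have "attaches\<^sup>*\<^sup>* G H'" using H(1) H'(1) by (rule rtranclp.rtrancl_into_rtrancl)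
      ultimately show ?thesis by blast
    qed
  qed blast
  have "finite (pverts G)" using clique_tree_simple[OF G(1)] by (simp add: simple_graph_iff)
  then have "finite (PiE (pverts G) (\<lambda>_. {1..k}))" by (simp add: finite_PiE)
  from ext[OF this] obtain H where H: "attaches\<^sup>*\<^sup>* G H" "\<And>\<phi>. k_clique_coloring H k \<phi> \<Longrightarrow>
      restrict \<phi> (pverts G) \<in> PiE (pverts G) (\<lambda>_. {1..k}) \<Longrightarrow> rich_clique H k \<phi> (Suc j) N"
    by blast
  have "clique_tree H" using G(1) H(1) unfolding clique_tree_def by (rule rtranclp_trans)
  moreover have "rich_clique H k \<phi> (Suc j) N" if "k_clique_coloring H k \<phi>" for \<phi>
  proof (rule H(2)[OF that])
    show "restrict \<phi> (pverts G) \<in> PiE (pverts G) (\<lambda>_. {1..k})"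
      using rtranclp_attaches_mono(3)[OF H(1) that] by (auto simp: k_clique_coloring_def)
  qed
  ultimately show ?case by blast
qed

theorem mainTheorem2:
  fixes k :: nat
  assumes "k \<ge> 2"
  shows "\<exists>G :: nat pair_pre_digraph.
    perfect G \<and> clique_chromatic_number G = k + 1 \<and> glued_from_cobipartite G"
proof -
  obtain G where G: "clique_tree G"
    "\<And>\<phi>. k_clique_coloring G k \<phi> \<Longrightarrow> rich_clique G k \<phi> (k + 1) 1"
    using rich_clique_unavoidable[OF assms order_refl] by blast
  have "\<not> rich_clique G k \<phi> (k + 1) 1" for \<phi>
  proof
    assume "rich_clique G k \<phi> (k + 1) 1"
    then obtain C where "C \<subseteq> {1..k}" "card C = k + 1" unfolding rich_clique_def by blast
    then show False using card_mono[of "{1..k}" C] by simp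
  qed
  then have "\<not> clique_colorable G k"
    using G(2) unfolding clique_colorable_def k_clique_coloring_def by blast
  \<comment> \<open>\<open>G\<close> itself may need more than \<open>k + 1\<close> colors, so it is
    replaced by a suitable graph arising in its construction.\<close>
  then obtain G' where "clique_tree G'" "clique_chromatic_number G' = k + 1"
    using clique_tree_exact_chromatic_number[OF G(1), of k] assms by auto
  then show ?thesis using clique_tree_perfect clique_tree_glued by blast
qed

end
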